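(* Let $(X,\mathcal B)$ be a standard Borel space, let $\Gamma\subset Aut(X,\mathcal B)$ be a hyperfinite countable group of Borel automorphisms acting freely on $X$, and let $G$ be a locally compact second countable abelian group. Then the subgroup of coboundaries $B^1(\Gamma\times X,G)$ is dense in the group of cocycles $Z^1(\Gamma\times X,G)$ with respect to the topology $\mathcal T$.
   Context: $Aut(X,\mathcal B)$ is the group of Borel automorphisms (Borel bijections of $X$ onto itself). A group $\Gamma$ acts freely if $\gamma x\ne x$ for all $x\in X$ and all $\gamma\in\Gamma$ different from the identity. The full group is $[\Gamma]=\{R\in Aut(X,\mathcal B): Rx\in\Gamma x\ \forall x\in X\}$. A countable subgroup $\Gamma\subset Aut(X,\mathcal B)$ is hyperfinite if there are finite subgroups $\Gamma_1\subset\Gamma_2\subset\cdots$ of $[\Gamma]$ with $\Gamma x=\bigcup_i\Gamma_i x$ for every $x\in X$. $G$ is written additively. A cocycle is a Borel function $a:\Gamma\times X\to G$ ($\Gamma$ discrete) with $a(\gamma_1\gamma_2,x)=a(\gamma_1,\gamma_2x)+a(\gamma_2,x)$ for all $\gamma_1,\gamma_2\in\Gamma$, $x\in X$, and $a(\mathbb 1,x)=0$, where $\mathbb 1$ is the identity map. It is a coboundary if there is a Borel $c:X\to G$ with $a(\gamma,x)=c(\gamma x)-c(x)$ for all $\gamma,x$. $Z^1(\Gamma\times X,G)$ and $B^1(\Gamma\times X,G)$ denote the groups of all cocycles and all coboundaries under pointwise addition. For a standard Borel space $Y$, $\mathcal F(Y,G)$ is the abelian group of all Borel functions $Y\to G$,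 and $\mathcal M_1(Y)$ is the set of Borel probability measures on $Y$. Fix a translation-invariant metric $d$ on $G$ compatible with its topology and write $|g-h|=d(g,h)$. The topology $\mathcal T$ on $\mathcal F(Y,G)$ has as base the sets $\{g\in\mathcal F(Y,G): \mu_i(\{y:|f(y)-g(y)|>\epsilon\})<\delta,\ i=1,\dots,n\}$, where $f\in\mathcal F(Y,G)$, $n\in\mathbb N$, $\mu_1,\dots,\mu_n\in\mathcal M_1(Y)$, $\epsilon,\delta>0$. The group $Z^1(\Gamma\times X,G)\subset\mathcal F(\Gamma\times X,G)$ carries the subspace topology, where $\Gamma\times X$ is a standard Borel space with $\Gamma$ discrete.
   Formalization: The sets displayed as a base of the topology T are taken as neighbourhood bases at their centres f, since with the strict inequality ">ε" they need not be open and do not form a base of any topology (e.g. closed intervals when the space is a point and G is the real line). *)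

theory Defs
  imports "HOL-Probability.Probability" "HOL-Algebra.Bij"
begin

text \<open>
  Standard Borel spaces are given by measures of which only \<open>space\<close> and \<open>sets\<close> matter.
\<close>

definition standard_borel :: "'x measure \<Rightarrow> bool" where
  "standard_borel X \<longleftrightarrow>
     (\<exists>T. completely_metrizable_space T \<and> second_countable T \<and> topspace T = space X
        \<and> sets X = sigma_sets (space X) {U. openin T U})"


text \<open>
  Automorphisms are extensional functions on \<open>space X\<close>, so that subgroups of \<open>Aut(X, \<B>)\<close> are
  those subgroups of \<^term>\<open>BijGroup (space X)\<close> that consist of Borel maps. In such a subgroup
  inverses are Borel by closure under inverses; for arbitrary Borel bijections of a standard Borel
  space this is the Lusin-Souslin theorem.
\<close>

definition borel_aut :: "'x measure \<Rightarrow> ('x \<Rightarrow> 'x) set" where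
  "borel_aut X = Bij (space X) \<inter> (X \<rightarrow>\<^sub>M X)"

definition borel_aut_subgroup :: "'x measure \<Rightarrow> ('x \<Rightarrow> 'x) set \<Rightarrow> bool" where
  "borel_aut_subgroup X \<Gamma> \<longleftrightarrow> subgroup \<Gamma> (BijGroup (space X)) \<and> \<Gamma> \<subseteq> borel_aut X"

definition orbit_of :: "('x \<Rightarrow> 'x) set \<Rightarrow> 'x \<Rightarrow> 'x set" where
  "orbit_of \<Gamma> x = (\<lambda>\<gamma>. \<gamma> x) ` \<Gamma>"

definition full_group :: "'x measure \<Rightarrow> ('x \<Rightarrow> 'x) set \<Rightarrow> ('x \<Rightarrow> 'x) set" where
  "full_group X \<Gamma> = {R \<in> borel_aut X. \<forall>x\<in>space X. R x \<in> orbit_of \<Gamma> x}"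

definition acts_freely :: "'x measure \<Rightarrow> ('x \<Rightarrow> 'x) set \<Rightarrow> bool" where
  "acts_freely X \<Gamma> \<longleftrightarrow>
     (\<forall>\<gamma>\<in>\<Gamma>. \<gamma> \<noteq> \<one>\<^bsub>BijGroup (space X)\<^esub> \<longrightarrow> (\<forall>x\<in>space X. \<gamma> x \<noteq> x))"

definition hyperfinite :: "'x measure \<Rightarrow> ('x \<Rightarrow> 'x) set \<Rightarrow> bool" where
  "hyperfinite X \<Gamma> \<longleftrightarrow>
     (\<exists>\<Gamma>s :: nat \<Rightarrow> ('x \<Rightarrow> 'x) set.
        (\<forall>i. finite (\<Gamma>s i) \<and> borel_aut_subgroup X (\<Gamma>s i) \<and> \<Gamma>s i \<subseteq> full_group X \<Gamma>)
      \<and> (\<forall>i. \<Gamma>s i \<subseteq> \<Gamma>s (Suc i))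
      \<and> (\<forall>x\<in>space X. orbit_of \<Gamma> x = (\<Union>i. orbit_of (\<Gamma>s i) x)))"


definition invariant_compatible_metric :: "('g::topological_ab_group_add \<Rightarrow> 'g \<Rightarrow> real) \<Rightarrow> bool" where
  "invariant_compatible_metric d \<longleftrightarrow>
     Metric_space UNIV d \<and> Metric_space.mtopology UNIV d = euclidean
     \<and> (\<forall>g h k. d (g + k) (h + k) = d g h)"

definition borel_fun :: "'y measure \<Rightarrow> ('y \<Rightarrow> 'g::topological_space) set" where
  "borel_fun Y = (Y \<rightarrow>\<^sub>M borel) \<inter> extensional (space Y)"

definition borel_fun_group :: "'y measure \<Rightarrow> ('y \<Rightarrow> 'g::topological_ab_group_add) monoid" where
  "borel_fun_group Y =
     \<lparr>carrier = borel_fun Y,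
      mult = \<lambda>f g. \<lambda>y\<in>space Y. f y + g y,
      one = \<lambda>y\<in>space Y. 0\<rparr>"

definition basic_nbhd ::
  "('g::topological_space \<Rightarrow> 'g \<Rightarrow> real) \<Rightarrow> 'y measure \<Rightarrow> ('y \<Rightarrow> 'g) \<Rightarrow> 'y measure set \<Rightarrow> real \<Rightarrow> real
     \<Rightarrow> ('y \<Rightarrow> 'g) set" where
  "basic_nbhd d Y f \<M> \<epsilon> \<delta> =
     {g \<in> borel_fun Y. \<forall>\<mu>\<in>\<M>. measure \<mu> {y \<in> space Y. d (f y) (g y) > \<epsilon>} < \<delta>}"

text \<open>
  The sets \<^term>\<open>basic_nbhd d Y f \<M> \<epsilon> \<delta>\<close> are used as a base of neighbourhoods \<^emph>\<open>at the point f\<close>.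
  Because of the strict inequality \<open>> \<epsilon>\<close> they need not be open (for a one-point \<open>Y\<close> they are closed
  \<open>\<epsilon>\<close>-balls), so they must not be fed to \<^const>\<open>topology_generated_by\<close>. The lemmas below
  show that they do form neighbourhood bases.
\<close>

definition openin_T :: "('g::topological_space \<Rightarrow> 'g \<Rightarrow> real) \<Rightarrow> 'y measure \<Rightarrow> ('y \<Rightarrow> 'g) set \<Rightarrow> bool" where
  "openin_T d Y W \<longleftrightarrow> W \<subseteq> borel_fun Y \<and>
     (\<forall>f\<in>W. \<exists>\<M> \<epsilon> \<delta>. finite \<M> \<and> \<M> \<subseteq> space (prob_algebra Y) \<and> \<epsilon> > 0 \<and> \<delta> > 0
        \<and> basic_nbhd d Y f \<M> \<epsilon> \<delta> \<subseteq> W)"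

definition topology_T :: "('g::topological_space \<Rightarrow> 'g \<Rightarrow> real) \<Rightarrow> 'y measure \<Rightarrow> ('y \<Rightarrow> 'g) topology" where
  "topology_T d Y = topology (openin_T d Y)"


text \<open>\<open>\<Gamma> \<times> X\<close> with \<open>\<Gamma>\<close> discrete.\<close>

definition action_space :: "'x measure \<Rightarrow> ('x \<Rightarrow> 'x) set \<Rightarrow> (('x \<Rightarrow> 'x) \<times> 'x) measure" where
  "action_space X \<Gamma> = count_space \<Gamma> \<Otimes>\<^sub>M X"

definition cocycles ::
  "'x measure \<Rightarrow> ('x \<Rightarrow> 'x) set \<Rightarrow> (('x \<Rightarrow> 'x) \<times> 'x \<Rightarrow> 'g::topological_ab_group_add) set" where
  "cocycles X \<Gamma> =
     {a \<in> borel_fun (action_space X \<Gamma>).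
        (\<forall>\<gamma>\<^sub>1\<in>\<Gamma>. \<forall>\<gamma>\<^sub>2\<in>\<Gamma>. \<forall>x\<in>space X.
           a (\<gamma>\<^sub>1 \<otimes>\<^bsub>BijGroup (space X)\<^esub> \<gamma>\<^sub>2, x) = a (\<gamma>\<^sub>1, \<gamma>\<^sub>2 x) + a (\<gamma>\<^sub>2, x))
        \<and> (\<forall>x\<in>space X. a (\<one>\<^bsub>BijGroup (space X)\<^esub>, x) = 0)}"

definition coboundaries ::
  "'x measure \<Rightarrow> ('x \<Rightarrow> 'x) set \<Rightarrow> (('x \<Rightarrow> 'x) \<times> 'x \<Rightarrow> 'g::topological_ab_group_add) set" where
  "coboundaries X \<Gamma> =
     {a \<in> cocycles X \<Gamma>. \<exists>c\<in>borel_fun X. \<forall>\<gamma>\<in>\<Gamma>. \<forall>x\<in>space X. a (\<gamma>, x) = c (\<gamma> x) - c x}"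


subsection \<open>Well-definedness\<close>

lemma metric_superlevel_open:
  fixes d :: "'g::topological_ab_group_add \<Rightarrow> 'g \<Rightarrow> real"
  assumes "invariant_compatible_metric d"
  shows "open {p. \<epsilon> < d (fst p) (snd p)}"
proof -
  interpret Metric_space UNIV d
    using assms by (simp add: invariant_compatible_metric_def)
  have top: "openin mtopology = open"
    using assms by (auto simp: invariant_compatible_metric_def)
  show ?thesis
  proof (subst open_subopen, rule ballI)
    fix p :: "'g \<times> 'g" assume p: "p \<in> {p. \<epsilon> < d (fst p) (snd p)}"
    define r where "r = (d (fst p) (snd p) - \<epsilon>) / 2"
    have r: "r > 0" using p by (simp add: r_def)
    have o: "open (mball (fst p) r)" "open (mball (snd p) r)"
      using openin_mball top by metis+
    have m: "p \<in> mball (fst p) r \<times> mball (snd p) r"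
      using r by (auto simp: mem_Times_iff)
    have "mball (fst p) r \<times> mball (snd p) r \<subseteq> {p. \<epsilon> < d (fst p) (snd p)}"
    proof
      fix q assume "q \<in> mball (fst p) r \<times> mball (snd p) r"
      then have 1: "d (fst p) (fst q) < r" "d (snd p) (snd q) < r"
        by (auto simp: mem_Times_iff)
      have "d (fst p) (snd p) \<le> d (fst p) (fst q) + d (fst q) (snd p)"
        "d (fst q) (snd p) \<le> d (fst q) (snd q) + d (snd q) (snd p)"
        by (rule triangle; simp)+
      then have "\<epsilon> < d (fst q) (snd q)"
        using 1 commute[of "snd q" "snd p"] unfolding r_def by (simp add: field_simps)
      then show "q \<in> {p. \<epsilon> < d (fst p) (snd p)}" by simp
    qed
    then show "\<exists>T. open T \<and> p \<in> T \<and> T \<subseteq> {p. \<epsilon> < d (fst p) (snd p)}"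
      using o m open_Times by blast
  qed
qed

lemma metric_superlevel_sets:
  fixes d :: "'g::{topological_ab_group_add, second_countable_topology} \<Rightarrow> 'g \<Rightarrow> real"
  assumes "invariant_compatible_metric d" "f \<in> borel_fun Y" "g \<in> borel_fun Y"
  shows "{y \<in> space Y. \<epsilon> < d (f y) (g y)} \<in> sets Y"
proof -
  have "(\<lambda>y. (f y, g y)) \<in> Y \<rightarrow>\<^sub>M borel"
    using assms(2,3) by (intro borel_measurable_Pair) (auto simp: borel_fun_def)
  from measurable_sets[OF this borel_open[OF metric_superlevel_open[OF assms(1), of \<epsilon>]]]
  show ?thesis by (simp add: vimage_def Int_def conj_commute)
qed

lemma basic_nbhd_mono:
  fixes d :: "'g::{topological_ab_group_add, second_countable_topology} \<Rightarrow> 'g \<Rightarrow> real"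
  assumes d: "invariant_compatible_metric d" and f: "f \<in> borel_fun Y"
    and M: "\<M>' \<subseteq> space (prob_algebra Y)" "\<M> \<subseteq> \<M>'" and "\<epsilon>' \<le> \<epsilon>" "\<delta>' \<le> \<delta>"
  shows "basic_nbhd d Y f \<M>' \<epsilon>' \<delta>' \<subseteq> basic_nbhd d Y f \<M> \<epsilon> \<delta>"
proof
  fix g assume g: "g \<in> basic_nbhd d Y f \<M>' \<epsilon>' \<delta>'"
  then have gF: "g \<in> borel_fun Y" by (simp add: basic_nbhd_def)
  have "measure \<mu> {y \<in> space Y. d (f y) (g y) > \<epsilon>} < \<delta>" if \<mu>: "\<mu> \<in> \<M>" for \<mu>
  proof -
    from \<mu> M have s: "sets \<mu> = sets Y" and "prob_space \<mu>" by (auto simp: space_prob_algebra)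
    then interpret prob_space \<mu> by simp
    have "measure \<mu> {y \<in> space Y. d (f y) (g y) > \<epsilon>} \<le> measure \<mu> {y \<in> space Y. d (f y) (g y) > \<epsilon>'}"
      using metric_superlevel_sets[OF d f gF] assms(5) s by (intro finite_measure_mono) auto
    also have "\<dots> < \<delta>'" using g \<mu> M by (auto simp: basic_nbhd_def)
    finally show ?thesis using assms by simp
  qed
  then show "g \<in> basic_nbhd d Y f \<M> \<epsilon> \<delta>" using gF by (simp add: basic_nbhd_def)
qed

lemma basic_nbhd_trans:
  fixes d :: "'g::{topological_ab_group_add, second_countable_topology} \<Rightarrow> 'g \<Rightarrow> real"
  assumes d: "invariant_compatible_metric d" and f: "f \<in> borel_fun Y"
    and M: "\<M> \<subseteq> space (prob_algebra Y)"
    and g: "g \<in> basic_nbhd d Y f \<M> (\<epsilon>/2) (\<delta>/2)"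
  shows "basic_nbhd d Y g \<M> (\<epsilon>/2) (\<delta>/2) \<subseteq> basic_nbhd d Y f \<M> \<epsilon> \<delta>"
proof
  interpret d: Metric_space UNIV d
    using d by (simp add: invariant_compatible_metric_def)
  fix h assume h: "h \<in> basic_nbhd d Y g \<M> (\<epsilon>/2) (\<delta>/2)"
  have gF: "g \<in> borel_fun Y" and hF: "h \<in> borel_fun Y"
    using g h by (auto simp: basic_nbhd_def)
  have "measure \<mu> {y \<in> space Y. d (f y) (h y) > \<epsilon>} < \<delta>" if \<mu>: "\<mu> \<in> \<M>" for \<mu>
  proof -
    let ?A = "{y \<in> space Y. d (f y) (g y) > \<epsilon>/2}" and ?B = "{y \<in> space Y. d (g y) (h y) > \<epsilon>/2}"
    from \<mu> M have s: "sets \<mu> = sets Y" and "prob_space \<mu>" by (auto simp: space_prob_algebra)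
    then interpret prob_space \<mu> by simp
    have AB: "?A \<in> sets \<mu>" "?B \<in> sets \<mu>"
      using metric_superlevel_sets[OF d f gF, of "\<epsilon>/2"] metric_superlevel_sets[OF d gF hF, of "\<epsilon>/2"] s
      by simp_all
    have "{y \<in> space Y. d (f y) (h y) > \<epsilon>} \<subseteq> ?A \<union> ?B"
    proof
      fix y assume "y \<in> {y \<in> space Y. d (f y) (h y) > \<epsilon>}"
      moreover have "d (f y) (h y) \<le> d (f y) (g y) + d (g y) (h y)"
        by (rule d.triangle) auto
      ultimately show "y \<in> ?A \<union> ?B" by auto
    qed
    then have "measure \<mu> {y \<in> space Y. d (f y) (h y) > \<epsilon>} \<le> measure \<mu> (?A \<union> ?B)"
      using AB by (intro finite_measure_mono) auto
    also have "\<dots> \<le> measure \<mu> ?A + measure \<mu> ?B" using AB by (rule measure_Un_le)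
    also have "\<dots> < \<delta>/2 + \<delta>/2"
      using g h \<mu> by (intro add_strict_mono) (auto simp: basic_nbhd_def)
    finally show ?thesis by simp
  qed
  then show "h \<in> basic_nbhd d Y f \<M> \<epsilon> \<delta>" using hF by (simp add: basic_nbhd_def)
qed

lemma istopology_openin_T:
  fixes d :: "'g::{topological_ab_group_add, second_countable_topology} \<Rightarrow> 'g \<Rightarrow> real"
  assumes d: "invariant_compatible_metric d"
  shows "istopology (openin_T d Y)"
  unfolding istopology_def
proof (intro conjI allI impI)
  fix S T assume S: "openin_T d Y S" and T: "openin_T d Y T"
  show "openin_T d Y (S \<inter> T)"
    unfolding openin_T_def
  proof (intro conjI ballI)
    show "S \<inter> T \<subseteq> borel_fun Y" using S by (auto simp: openin_T_def)
    fix f assume f: "f \<in> S \<inter> T"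
    then have fF: "f \<in> borel_fun Y" using S by (auto simp: openin_T_def)
    obtain \<M>1 \<epsilon>1 \<delta>1 where 1: "finite \<M>1" "\<M>1 \<subseteq> space (prob_algebra Y)" "\<epsilon>1 > 0" "\<delta>1 > 0"
      "basic_nbhd d Y f \<M>1 \<epsilon>1 \<delta>1 \<subseteq> S"
      using S f unfolding openin_T_def by (meson IntD1)
    obtain \<M>2 \<epsilon>2 \<delta>2 where 2: "finite \<M>2" "\<M>2 \<subseteq> space (prob_algebra Y)" "\<epsilon>2 > 0" "\<delta>2 > 0"
      "basic_nbhd d Y f \<M>2 \<epsilon>2 \<delta>2 \<subseteq> T"
      using T f unfolding openin_T_def by (meson IntD2)
    have "basic_nbhd d Y f (\<M>1 \<union> \<M>2) (min \<epsilon>1 \<epsilon>2) (min \<delta>1 \<delta>2) \<subseteq> S \<inter> T"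
      using basic_nbhd_mono[OF d fF, of "\<M>1 \<union> \<M>2" \<M>1 "min \<epsilon>1 \<epsilon>2" \<epsilon>1 "min \<delta>1 \<delta>2" \<delta>1]
        basic_nbhd_mono[OF d fF, of "\<M>1 \<union> \<M>2" \<M>2 "min \<epsilon>1 \<epsilon>2" \<epsilon>2 "min \<delta>1 \<delta>2" \<delta>2] 1 2
      by auto
    then show "\<exists>\<M> \<epsilon> \<delta>. finite \<M> \<and> \<M> \<subseteq> space (prob_algebra Y) \<and> \<epsilon> > 0 \<and> \<delta> > 0
        \<and> basic_nbhd d Y f \<M> \<epsilon> \<delta> \<subseteq> S \<inter> T"
      using 1 2 by (intro exI[of _ "\<M>1 \<union> \<M>2"] exI[of _ "min \<epsilon>1 \<epsilon>2"] exI[of _ "min \<delta>1 \<delta>2"]) auto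
  qed
next
  fix \<K> assume K: "\<forall>K\<in>\<K>. openin_T d Y K"
  show "openin_T d Y (\<Union>\<K>)"
    unfolding openin_T_def
  proof (intro conjI ballI)
    show "\<Union>\<K> \<subseteq> borel_fun Y" using K by (auto simp: openin_T_def)
    fix f assume "f \<in> \<Union>\<K>"
    then obtain K where "K \<in> \<K>" "f \<in> K" by auto
    moreover then obtain \<M> \<epsilon> \<delta> where "finite \<M>" "\<M> \<subseteq> space (prob_algebra Y)" "\<epsilon> > 0" "\<delta> > 0"
      "basic_nbhd d Y f \<M> \<epsilon> \<delta> \<subseteq> K"
      using K unfolding openin_T_def by meson
    ultimately show "\<exists>\<M> \<epsilon> \<delta>. finite \<M> \<and> \<M> \<subseteq> space (prob_algebra Y) \<and> \<epsilon> > 0 \<and> \<delta> > 0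
        \<and> basic_nbhd d Y f \<M> \<epsilon> \<delta> \<subseteq> \<Union>\<K>"
      by (metis Union_upper subset_trans)
  qed
qed

lemma openin_topology_T:
  fixes d :: "'g::{topological_ab_group_add, second_countable_topology} \<Rightarrow> 'g \<Rightarrow> real"
  assumes "invariant_compatible_metric d"
  shows "openin (topology_T d Y) = openin_T d Y"
  unfolding topology_T_def using istopology_openin_T[OF assms] by (rule topology_inverse')

lemma topspace_topology_T:
  fixes d :: "'g::{topological_ab_group_add, second_countable_topology} \<Rightarrow> 'g \<Rightarrow> real"
  assumes "invariant_compatible_metric d"
  shows "topspace (topology_T d Y) = borel_fun Y"
proof
  show "topspace (topology_T d Y) \<subseteq> borel_fun Y"
    using openin_topspace[of "topology_T d Y"]
    unfolding openin_topology_T[OF assms] openin_T_def by blast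
  have "openin_T d Y (borel_fun Y)"
    unfolding openin_T_def
    by (intro conjI ballI exI[of _ "{}"] exI[of _ "1::real"]) (auto simp: basic_nbhd_def)
  then show "borel_fun Y \<subseteq> topspace (topology_T d Y)"
    using openin_subset openin_topology_T[OF assms] by metis
qed

lemma basic_nbhd_is_nbhd:
  fixes d :: "'g::{topological_ab_group_add, second_countable_topology} \<Rightarrow> 'g \<Rightarrow> real"
  assumes d: "invariant_compatible_metric d" and f: "f \<in> borel_fun Y"
    and M: "finite \<M>" "\<M> \<subseteq> space (prob_algebra Y)" and pos: "\<epsilon> > 0" "\<delta> > 0"
  shows "\<exists>W. openin (topology_T d Y) W \<and> f \<in> W \<and> W \<subseteq> basic_nbhd d Y f \<M> \<epsilon> \<delta>"
proof -
  interpret d: Metric_space UNIV d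
    using d by (simp add: invariant_compatible_metric_def)
  have self: "g \<in> basic_nbhd d Y g \<M> e s" if "g \<in> borel_fun Y" "e > 0" "s > 0" for g e s
    using that by (simp add: basic_nbhd_def)
  define W where "W = {g \<in> borel_fun Y. \<exists>e>0. \<exists>s>0. basic_nbhd d Y g \<M> e s \<subseteq> basic_nbhd d Y f \<M> \<epsilon> \<delta>}"
  have "openin_T d Y W"
    unfolding openin_T_def
  proof (intro conjI ballI)
    show "W \<subseteq> borel_fun Y" by (auto simp: W_def)
    fix g assume "g \<in> W"
    then obtain e s where g: "g \<in> borel_fun Y" "e > 0" "s > 0"
      "basic_nbhd d Y g \<M> e s \<subseteq> basic_nbhd d Y f \<M> \<epsilon> \<delta>" by (auto simp: W_def)
    have "basic_nbhd d Y g \<M> (e/2) (s/2) \<subseteq> W"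
    proof
      fix h assume h: "h \<in> basic_nbhd d Y g \<M> (e/2) (s/2)"
      from basic_nbhd_trans[OF d g(1) M(2) h] g(4)
      have "basic_nbhd d Y h \<M> (e/2) (s/2) \<subseteq> basic_nbhd d Y f \<M> \<epsilon> \<delta>" by simp
      moreover have "h \<in> borel_fun Y" using h by (simp add: basic_nbhd_def)
      moreover have "e/2 > 0" "s/2 > 0" using g by auto
      ultimately show "h \<in> W" unfolding W_def by blast
    qed
    then show "\<exists>\<M> \<epsilon> \<delta>. finite \<M> \<and> \<M> \<subseteq> space (prob_algebra Y) \<and> \<epsilon> > 0 \<and> \<delta> > 0
        \<and> basic_nbhd d Y g \<M> \<epsilon> \<delta> \<subseteq> W"
      using M g by (intro exI[of _ \<M>] exI[of _ "e/2"] exI[of _ "s/2"]) auto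
  qed
  moreover have "f \<in> W" using f pos unfolding W_def by blast
  moreover have "W \<subseteq> basic_nbhd d Y f \<M> \<epsilon> \<delta>" using self unfolding W_def by blast
  ultimately show ?thesis unfolding openin_topology_T[OF d] by blast
qed

lemma uminus_borel_fun:
  fixes f :: "'y \<Rightarrow> 'g::topological_ab_group_add"
  assumes "f \<in> borel_fun Y"
  shows "(\<lambda>y\<in>space Y. - f y) \<in> borel_fun Y"
proof -
  have "(\<lambda>y. - f y) \<in> Y \<rightarrow>\<^sub>M borel"
    using assms unfolding borel_fun_def
    by (intro measurable_compose[of f Y borel uminus borel] borel_measurable_continuous_onI
          continuous_intros) auto
  then show ?thesis by (simp add: borel_fun_def cong: measurable_cong)
qed

lemma comm_group_borel_fun_group:
  "comm_group (borel_fun_group Y :: ('y \<Rightarrow> 'g::{topological_ab_group_add, second_countable_topology}) monoid)"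
proof (rule comm_groupI)
  fix f :: "'y \<Rightarrow> 'g" assume f: "f \<in> carrier (borel_fun_group Y)"
  then have "(\<lambda>y\<in>space Y. - f y) \<in> carrier (borel_fun_group Y)"
    by (simp add: borel_fun_group_def uminus_borel_fun)
  moreover have "(\<lambda>y\<in>space Y. - f y) \<otimes>\<^bsub>borel_fun_group Y\<^esub> f = \<one>\<^bsub>borel_fun_group Y\<^esub>"
    by (auto simp: borel_fun_group_def fun_eq_iff)
  ultimately show "\<exists>g\<in>carrier (borel_fun_group Y). g \<otimes>\<^bsub>borel_fun_group Y\<^esub> f = \<one>\<^bsub>borel_fun_group Y\<^esub>"
    by blast
qed (auto simp: borel_fun_group_def borel_fun_def fun_eq_iff extensional_def add.assoc add.commute
       cong: measurable_cong)

lemma inv_borel_fun_group: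
  fixes f :: "'y \<Rightarrow> 'g::{topological_ab_group_add, second_countable_topology}"
  assumes "f \<in> borel_fun Y"
  shows "inv\<^bsub>borel_fun_group Y\<^esub> f = (\<lambda>y\<in>space Y. - f y)"
proof -
  interpret comm_group "borel_fun_group Y :: ('y \<Rightarrow> 'g) monoid"
    by (rule comm_group_borel_fun_group)
  show ?thesis
    by (rule inv_equality)
      (use assms in \<open>auto simp: borel_fun_group_def uminus_borel_fun fun_eq_iff\<close>)
qed

lemma borel_aut_subgroup_simps:
  assumes "borel_aut_subgroup X \<Gamma>"
  shows "\<one>\<^bsub>BijGroup (space X)\<^esub> \<in> \<Gamma>"
    and "\<gamma>\<^sub>1 \<in> \<Gamma> \<Longrightarrow> \<gamma>\<^sub>2 \<in> \<Gamma> \<Longrightarrow> \<gamma>\<^sub>1 \<otimes>\<^bsub>BijGroup (space X)\<^esub> \<gamma>\<^sub>2 \<in> \<Gamma>"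
    and "\<gamma> \<in> \<Gamma> \<Longrightarrow> x \<in> space X \<Longrightarrow> \<gamma> x \<in> space X"
  using assms unfolding borel_aut_subgroup_def borel_aut_def
  by (auto simp: subgroup.one_closed subgroup.m_closed dest!: subsetD intro: measurable_space)

lemma subgroup_cocycles:
  assumes "borel_aut_subgroup X \<Gamma>"
  shows "subgroup (cocycles X \<Gamma> :: (_ \<Rightarrow> 'g::{topological_ab_group_add, second_countable_topology}) set)
           (borel_fun_group (action_space X \<Gamma>))"
proof -
  interpret F: comm_group "borel_fun_group (action_space X \<Gamma>) :: (_ \<Rightarrow> 'g) monoid"
    by (rule comm_group_borel_fun_group)
  note [simp] = borel_aut_subgroup_simps[OF assms]
  have sp: "space (action_space X \<Gamma>) = \<Gamma> \<times> space X"
    by (simp add: action_space_def space_pair_measure)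
  show ?thesis
  proof (rule F.subgroupI)
    show "cocycles X \<Gamma> \<subseteq> carrier (borel_fun_group (action_space X \<Gamma>))"
      by (auto simp: cocycles_def borel_fun_group_def)
    have "\<one>\<^bsub>borel_fun_group (action_space X \<Gamma>)\<^esub> \<in> (cocycles X \<Gamma> :: (_ \<Rightarrow> 'g) set)"
      using F.one_closed by (auto simp: cocycles_def borel_fun_group_def sp)
    then show "cocycles X \<Gamma> \<noteq> ({} :: (_ \<Rightarrow> 'g) set)" by blast
  next
    fix a :: "_ \<Rightarrow> 'g" assume a: "a \<in> cocycles X \<Gamma>"
    then have aF: "a \<in> borel_fun (action_space X \<Gamma>)" by (simp add: cocycles_def)
    then have "inv\<^bsub>borel_fun_group (action_space X \<Gamma>)\<^esub> a \<in> borel_fun (action_space X \<Gamma>)"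
      using F.inv_closed[of a] by (simp add: borel_fun_group_def)
    then show "inv\<^bsub>borel_fun_group (action_space X \<Gamma>)\<^esub> a \<in> cocycles X \<Gamma>"
      using a by (simp add: cocycles_def inv_borel_fun_group sp)
  next
    fix a b :: "_ \<Rightarrow> 'g" assume ab: "a \<in> cocycles X \<Gamma>" "b \<in> cocycles X \<Gamma>"
    then have "a \<otimes>\<^bsub>borel_fun_group (action_space X \<Gamma>)\<^esub> b \<in> borel_fun (action_space X \<Gamma>)"
      using F.m_closed[of a b] by (simp add: borel_fun_group_def cocycles_def)
    then show "a \<otimes>\<^bsub>borel_fun_group (action_space X \<Gamma>)\<^esub> b \<in> cocycles X \<Gamma>"
      using ab by (simp add: cocycles_def borel_fun_group_def sp algebra_simps)
  qed
qed

lemma subgroup_coboundaries: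
  assumes "borel_aut_subgroup X \<Gamma>"
  shows "subgroup (coboundaries X \<Gamma> :: (_ \<Rightarrow> 'g::{topological_ab_group_add, second_countable_topology}) set)
           (borel_fun_group (action_space X \<Gamma>))"
proof -
  interpret F: comm_group "borel_fun_group (action_space X \<Gamma>) :: (_ \<Rightarrow> 'g) monoid"
    by (rule comm_group_borel_fun_group)
  interpret C: comm_group "borel_fun_group X :: (_ \<Rightarrow> 'g) monoid"
    by (rule comm_group_borel_fun_group)
  interpret Z: subgroup "cocycles X \<Gamma> :: (_ \<Rightarrow> 'g) set" "borel_fun_group (action_space X \<Gamma>)"
    by (rule subgroup_cocycles[OF assms])
  note [simp] = borel_aut_subgroup_simps[OF assms]
  have sp: "space (action_space X \<Gamma>) = \<Gamma> \<times> space X"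
    by (simp add: action_space_def space_pair_measure)
  show ?thesis
  proof (rule F.subgroupI)
    show "coboundaries X \<Gamma> \<subseteq> carrier (borel_fun_group (action_space X \<Gamma>))"
      by (auto simp: coboundaries_def cocycles_def borel_fun_group_def)
    have "(\<lambda>x\<in>space X. 0) \<in> (borel_fun X :: (_ \<Rightarrow> 'g) set)"
      using C.one_closed by (simp add: borel_fun_group_def)
    then have "\<one>\<^bsub>borel_fun_group (action_space X \<Gamma>)\<^esub> \<in> (coboundaries X \<Gamma> :: (_ \<Rightarrow> 'g) set)"
      using Z.one_closed unfolding coboundaries_def
      by (auto simp: borel_fun_group_def sp intro!: bexI[of _ "\<lambda>x\<in>space X. 0"])
    then show "coboundaries X \<Gamma> \<noteq> ({} :: (_ \<Rightarrow> 'g) set)" by blast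
  next
    fix a :: "_ \<Rightarrow> 'g" assume a: "a \<in> coboundaries X \<Gamma>"
    then obtain c where c: "c \<in> borel_fun X" "\<forall>\<gamma>\<in>\<Gamma>. \<forall>x\<in>space X. a (\<gamma>, x) = c (\<gamma> x) - c x"
      by (auto simp: coboundaries_def)
    have aZ: "a \<in> cocycles X \<Gamma>" "a \<in> borel_fun (action_space X \<Gamma>)"
      using a by (auto simp: coboundaries_def cocycles_def)
    have "(\<lambda>x\<in>space X. - c x) \<in> borel_fun X"
      using C.inv_closed[of c] c(1) inv_borel_fun_group[OF c(1)] by (simp add: borel_fun_group_def)
    then show "inv\<^bsub>borel_fun_group (action_space X \<Gamma>)\<^esub> a \<in> coboundaries X \<Gamma>"
      using Z.m_inv_closed[OF aZ(1)] c(2) unfolding coboundaries_def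
      by (auto simp: inv_borel_fun_group[OF aZ(2)] sp intro!: bexI[of _ "\<lambda>x\<in>space X. - c x"])
  next
    fix a b :: "_ \<Rightarrow> 'g" assume ab: "a \<in> coboundaries X \<Gamma>" "b \<in> coboundaries X \<Gamma>"
    then obtain c e where c: "c \<in> borel_fun X" "\<forall>\<gamma>\<in>\<Gamma>. \<forall>x\<in>space X. a (\<gamma>, x) = c (\<gamma> x) - c x"
      and e: "e \<in> borel_fun X" "\<forall>\<gamma>\<in>\<Gamma>. \<forall>x\<in>space X. b (\<gamma>, x) = e (\<gamma> x) - e x"
      by (auto simp: coboundaries_def)
    have abZ: "a \<in> cocycles X \<Gamma>" "b \<in> cocycles X \<Gamma>"
      using ab by (auto simp: coboundaries_def)
    have "(\<lambda>x\<in>space X. c x + e x) \<in> borel_fun X"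
      using C.m_closed[of c e] c(1) e(1) by (simp add: borel_fun_group_def)
    then show "a \<otimes>\<^bsub>borel_fun_group (action_space X \<Gamma>)\<^esub> b \<in> coboundaries X \<Gamma>"
      using Z.m_closed[OF abZ] c(2) e(2) unfolding coboundaries_def
      by (auto simp: borel_fun_group_def sp algebra_simps intro!: bexI[of _ "\<lambda>x\<in>space X. c x + e x"])
  qed
qed

end

theory Submission
  imports Defs
begin

text \<open>
  A finite group \<open>F\<close> of Borel automorphisms has a Borel selector \<open>s\<close> for its orbits. If
  \<open>F x \<subseteq> \<Gamma> x\<close>, freeness of \<open>\<Gamma>\<close> gives a unique \<open>t x \<in> \<Gamma>\<close> with \<open>t x\<close> mapping \<open>x\<close> to \<open>s x\<close>,
  and \<open>c x = - a (t x, x)\<close> satisfies \<open>a (\<gamma>, x) = c (\<gamma> x) - c x\<close> as soon as \<open>\<gamma> x \<in> F x\<close>.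
  Along an exhausting sequence of finite groups the exceptional sets, where
  \<open>\<gamma> x \<notin> \<Gamma>\<^sub>i x\<close>, decrease to the empty set, so their measures tend to 0.
\<close>

section \<open>Countable families of Borel sets that separate points\<close>

text \<open>The indicator sequences of such a family map the space injectively and measurably into
  Cantor space. The index type \<open>nat\<close> provides the order of the coordinates for the
  lexicographic comparison below.\<close>

definition borel_separating :: "'x measure \<Rightarrow> (nat \<Rightarrow> 'x set) \<Rightarrow> bool" where
  "borel_separating X B \<longleftrightarrow> range B \<subseteq> sets X
     \<and> (\<forall>x\<in>space X. \<forall>y\<in>space X. (\<forall>n. x \<in> B n \<longleftrightarrow> y \<in> B n) \<longrightarrow> x = y)"

lemma borel_separatingD:
  assumes "borel_separating X B"
  shows "B n \<in> sets X"
    and "x \<in> space X \<Longrightarrow> y \<in> space X \<Longrightarrow> (\<And>n. x \<in> B n \<longleftrightarrow> y \<in> B n) \<Longrightarrow> x = y"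
  using assms unfolding borel_separating_def by auto

text \<open>A countable base does it: metrizable spaces are T1, so for distinct points some basic
  open set contains the first and misses the second.\<close>

lemma standard_borel_separating:
  assumes "standard_borel X"
  shows "\<exists>B. borel_separating X B"
proof -
  obtain T where T: "completely_metrizable_space T" "second_countable T" "topspace T = space X"
    "sets X = sigma_sets (space X) {U. openin T U}"
    using assms by (auto simp: standard_borel_def)
  obtain \<B> where \<B>: "countable \<B>" "\<And>V. V \<in> \<B> \<Longrightarrow> openin T V"
    "\<And>U x. openin T U \<Longrightarrow> x \<in> U \<Longrightarrow> \<exists>V\<in>\<B>. x \<in> V \<and> V \<subseteq> U"
    using T(2) unfolding second_countable_def by metis
  have t1: "t1_space T"
    using T(1) completely_metrizable_imp_metrizable_space metrizable_imp_t1_space by blast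
  \<comment> \<open>The base may be empty when the space is; adding \<open>{}\<close> makes the
    enumerated set nonempty, so that \<open>range B\<close> is exactly this set.\<close>
  define B where "B = from_nat_into (insert {} \<B>)"
  have range_B: "range B = insert {} \<B>"
    using \<B>(1) unfolding B_def by (intro range_from_nat_into) auto
  have "B n \<in> sets X" for n
  proof -
    have "openin T (B n)" using range_B \<B>(2) by (metis insert_iff openin_empty rangeI)
    then show ?thesis using T(4) by auto
  qed
  moreover have "x = y"
    if xy: "x \<in> space X" "y \<in> space X" and eq: "\<forall>n. x \<in> B n \<longleftrightarrow> y \<in> B n" for x y
  proof (rule ccontr)
    assume "x \<noteq> y"
    then obtain U where "openin T U" "x \<in> U" "y \<notin> U"
      using t1 xy T(3) unfolding t1_space_def by metis
    then obtain V where "V \<in> \<B>" "x \<in> V" "y \<notin> V" using \<B>(3) by blast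
    then show False using eq range_B by (metis insertCI rangeE)
  qed
  ultimately have "borel_separating X B"
    unfolding borel_separating_def by blast
  then show ?thesis by blast
qed

section \<open>Lexicographic order and measurability of comparisons\<close>

text \<open>The lexicographic order of the indicator sequences of \<open>B\<close>.\<close>

definition lex_less :: "(nat \<Rightarrow> 'x set) \<Rightarrow> 'x \<Rightarrow> 'x \<Rightarrow> bool" where
  "lex_less B x y \<longleftrightarrow> (\<exists>n. x \<notin> B n \<and> y \<in> B n \<and> (\<forall>m<n. x \<in> B m \<longleftrightarrow> y \<in> B m))"

lemma lex_less_irrefl: "\<not> lex_less B x x"
  by (simp add: lex_less_def)

lemma lex_less_trans:
  assumes "lex_less B x y" "lex_less B y z"
  shows "lex_less B x z"
proof -
  obtain n where n: "x \<notin> B n" "y \<in> B n" "\<forall>m<n. x \<in> B m \<longleftrightarrow> y \<in> B m"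
    using assms(1) by (auto simp: lex_less_def)
  obtain k where k: "y \<notin> B k" "z \<in> B k" "\<forall>m<k. y \<in> B m \<longleftrightarrow> z \<in> B m"
    using assms(2) by (auto simp: lex_less_def)
  have "n \<noteq> k" using n k by auto
  then consider "n < k" | "k < n" by linarith
  then show ?thesis
  proof cases
    case 1
    then show ?thesis using n k unfolding lex_less_def by (intro exI[of _ n]) auto
  next
    case 2
    then show ?thesis using n k unfolding lex_less_def by (intro exI[of _ k]) auto
  qed
qed

text \<open>The first index at which the two indicator sequences differ decides the
  comparison.\<close>

lemma lex_less_total:
  assumes "\<exists>n. \<not> (x \<in> B n \<longleftrightarrow> y \<in> B n)"
  shows "lex_less B x y \<or> lex_less B y x"
proof -
  define n where "n = (LEAST n. \<not> (x \<in> B n \<longleftrightarrow> y \<in> B n))"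
  have "\<not> (x \<in> B n \<longleftrightarrow> y \<in> B n)"
    unfolding n_def by (rule LeastI_ex[OF assms])
  moreover have "\<forall>m<n. x \<in> B m \<longleftrightarrow> y \<in> B m"
    using not_less_Least[of _ "\<lambda>n. \<not> (x \<in> B n \<longleftrightarrow> y \<in> B n)"] unfolding n_def by blast
  ultimately show ?thesis unfolding lex_less_def by blast
qed

text \<open>Irreflexivity and transitivity yield a minimal element. Its uniqueness comes later, from
  \<open>lex_less_total\<close> together with separation of points.\<close>

lemma lex_less_has_min:
  assumes "finite S" "S \<noteq> {}"
  shows "\<exists>m\<in>S. \<forall>y\<in>S. \<not> lex_less B y m"
  using assms
proof (induction rule: finite_ne_induct)
  case (singleton x)
  then show ?case by (simp add: lex_less_irrefl)
next
  case (insert x S)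
  then obtain m where m: "m \<in> S" "\<forall>y\<in>S. \<not> lex_less B y m" by blast
  show ?case
  proof (cases "lex_less B x m")
    case True
    then have "\<forall>y\<in>insert x S. \<not> lex_less B y x"
      using m lex_less_irrefl lex_less_trans by (metis insert_iff)
    then show ?thesis by blast
  next
    case False
    then show ?thesis using m by auto
  qed
qed

lemma pred_lex_less:
  assumes [measurable]: "\<And>n. B n \<in> sets X" "f \<in> Y \<rightarrow>\<^sub>M X" "g \<in> Y \<rightarrow>\<^sub>M X"
  shows "Measurable.pred Y (\<lambda>x. lex_less B (f x) (g x))"
  unfolding lex_less_def by measurable

text \<open>Equality of two points amounts to countably many membership tests against the sets
  \<open>B n\<close>.\<close>

lemma pred_eq_separating:
  assumes B: "borel_separating X B"
    and [measurable]: "f \<in> Y \<rightarrow>\<^sub>M X" "g \<in> Y \<rightarrow>\<^sub>M X"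
  shows "Measurable.pred Y (\<lambda>x. f x = g x)"
proof -
  note [measurable] = borel_separatingD(1)[OF B]
  have "Measurable.pred Y (\<lambda>x. \<forall>n. f x \<in> B n \<longleftrightarrow> g x \<in> B n)"
    by measurable
  moreover have "(\<forall>n. f x \<in> B n \<longleftrightarrow> g x \<in> B n) \<longleftrightarrow> f x = g x" if "x \<in> space Y" for x
    using borel_separatingD(2)[OF B, of "f x" "g x"] measurable_space[OF assms(2) that]
      measurable_space[OF assms(3) that]
    by auto
  ultimately show ?thesis by (simp cong: measurable_cong)
qed

section \<open>Groups of Borel automorphisms and their orbits\<close>

lemma borel_aut_subgroupD:
  assumes "borel_aut_subgroup X \<Gamma>"
  shows "\<gamma> \<in> \<Gamma> \<Longrightarrow> \<gamma> \<in> X \<rightarrow>\<^sub>M X"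
    and "\<gamma> \<in> \<Gamma> \<Longrightarrow> \<gamma> \<in> Bij (space X)"
    and "\<gamma> \<in> \<Gamma> \<Longrightarrow> \<eta> \<in> \<Gamma> \<Longrightarrow> x \<in> space X \<Longrightarrow> (\<gamma> \<otimes>\<^bsub>BijGroup (space X)\<^esub> \<eta>) x = \<gamma> (\<eta> x)"
    and "\<gamma> \<in> \<Gamma> \<Longrightarrow> \<exists>\<eta>\<in>\<Gamma>. \<eta> \<otimes>\<^bsub>BijGroup (space X)\<^esub> \<gamma> = \<one>\<^bsub>BijGroup (space X)\<^esub>"
proof -
  have sg: "subgroup \<Gamma> (BijGroup (space X))" and sub: "\<Gamma> \<subseteq> borel_aut X"
    using assms by (auto simp: borel_aut_subgroup_def)
  interpret group "BijGroup (space X)" by (rule group_BijGroup)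
  show "\<gamma> \<in> \<Gamma> \<Longrightarrow> \<gamma> \<in> X \<rightarrow>\<^sub>M X" and bij: "\<gamma> \<in> \<Gamma> \<Longrightarrow> \<gamma> \<in> Bij (space X)" for \<gamma>
    using sub by (auto simp: borel_aut_def)
  show "(\<gamma> \<otimes>\<^bsub>BijGroup (space X)\<^esub> \<eta>) x = \<gamma> (\<eta> x)" if "\<gamma> \<in> \<Gamma>" "\<eta> \<in> \<Gamma>" "x \<in> space X"
    using bij[OF that(1)] bij[OF that(2)] that(3) by (simp add: BijGroup_def compose_def)
  show "\<exists>\<eta>\<in>\<Gamma>. \<eta> \<otimes>\<^bsub>BijGroup (space X)\<^esub> \<gamma> = \<one>\<^bsub>BijGroup (space X)\<^esub>" if "\<gamma> \<in> \<Gamma>"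
    using that sg subgroup.m_inv_closed[OF sg that] subgroup.mem_carrier[OF sg that]
    by (intro bexI[of _ "inv\<^bsub>BijGroup (space X)\<^esub> \<gamma>"]) auto
qed

lemma one_BijGroup_apply: "x \<in> S \<Longrightarrow> \<one>\<^bsub>BijGroup S\<^esub> x = x"
  by (simp add: BijGroup_def)

text \<open>If \<open>\<theta>\<close> inverts \<open>\<eta>\<close>, then \<open>\<theta>\<close>
  composed with \<open>\<gamma>\<close> fixes \<open>x\<close>, so freeness makes it the identity,
  and \<open>\<theta>\<close> cancels. Points of an orbit thus correspond to unique group
  elements.\<close>

lemma acts_freely_inj:
  assumes \<Gamma>: "borel_aut_subgroup X \<Gamma>" and free: "acts_freely X \<Gamma>"
    and "\<gamma> \<in> \<Gamma>" "\<eta> \<in> \<Gamma>" "x \<in> space X" "\<gamma> x = \<eta> x"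
  shows "\<gamma> = \<eta>"
proof -
  let ?G = "BijGroup (space X)"
  interpret group ?G by (rule group_BijGroup)
  have sg: "subgroup \<Gamma> ?G" using \<Gamma> by (simp add: borel_aut_subgroup_def)
  obtain \<theta> where \<theta>: "\<theta> \<in> \<Gamma>" "\<theta> \<otimes>\<^bsub>?G\<^esub> \<eta> = \<one>\<^bsub>?G\<^esub>"
    using borel_aut_subgroupD(4)[OF \<Gamma> assms(4)] by blast
  have "(\<theta> \<otimes>\<^bsub>?G\<^esub> \<gamma>) x = (\<theta> \<otimes>\<^bsub>?G\<^esub> \<eta>) x"
    using assms \<theta>(1) by (simp add: borel_aut_subgroupD(3)[OF \<Gamma>])
  then have "(\<theta> \<otimes>\<^bsub>?G\<^esub> \<gamma>) x = x" using \<theta>(2) assms(5) by (simp add: one_BijGroup_apply)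
  then have "\<theta> \<otimes>\<^bsub>?G\<^esub> \<gamma> = \<theta> \<otimes>\<^bsub>?G\<^esub> \<eta>"
    using free \<theta> assms(3,5) borel_aut_subgroup_simps(2)[OF \<Gamma>] unfolding acts_freely_def by metis
  then show ?thesis
    using Units_l_cancel Units_eq subgroup.mem_carrier[OF sg] assms(3,4) \<theta>(1) by metis
qed

text \<open>Closure under products gives one inclusion; the same inclusion for the inverse of
  \<open>g\<close> at the point \<open>g x\<close> gives the other.\<close>

lemma orbit_of_apply:
  assumes F: "borel_aut_subgroup X F" and "g \<in> F" "x \<in> space X"
  shows "orbit_of F (g x) = orbit_of F x"
proof -
  note ap = borel_aut_subgroupD(3)[OF F]
  have sub: "orbit_of F (h y) \<subseteq> orbit_of F y" if "h \<in> F" "y \<in> space X" for h y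
  proof
    fix z assume "z \<in> orbit_of F (h y)"
    then obtain k where k: "k \<in> F" "z = k (h y)" by (auto simp: orbit_of_def)
    then have "z = (k \<otimes>\<^bsub>BijGroup (space X)\<^esub> h) y" using ap that by simp
    then show "z \<in> orbit_of F y"
      using borel_aut_subgroup_simps(2)[OF F k(1) that(1)] by (auto simp: orbit_of_def)
  qed
  obtain \<theta> where \<theta>: "\<theta> \<in> F" "\<theta> \<otimes>\<^bsub>BijGroup (space X)\<^esub> g = \<one>\<^bsub>BijGroup (space X)\<^esub>"
    using borel_aut_subgroupD(4)[OF F assms(2)] by blast
  then have "\<theta> (g x) = x"
    using ap[OF \<theta>(1) assms(2,3)] assms(3) by (simp add: one_BijGroup_apply)
  then have "orbit_of F x \<subseteq> orbit_of F (g x)"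
    using sub[OF \<theta>(1), of "g x"] borel_aut_subgroup_simps(3)[OF F assms(2,3)] by simp
  then show ?thesis using sub[OF assms(2,3)] by blast
qed

text \<open>Since \<open>F\<close> is finite, this is a finite disjunction of equalities between
  measurable maps.\<close>

lemma pred_orbit_of:
  fixes X :: "'x measure"
  assumes X: "standard_borel X" and F: "finite F" "borel_aut_subgroup X F" and \<gamma>: "\<gamma> \<in> X \<rightarrow>\<^sub>M X"
  shows "Measurable.pred X (\<lambda>x. \<gamma> x \<in> orbit_of F x)"
proof -
  obtain B where B: "borel_separating X B"
    using standard_borel_separating[OF X] ..
  have "Measurable.pred X (\<lambda>x. \<exists>g\<in>F. \<gamma> x = g x)"
    using F(1) pred_eq_separating[OF B \<gamma>] borel_aut_subgroupD(1)[OF F(2)]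
    by (intro pred_intros_finite) auto
  then show ?thesis by (simp add: orbit_of_def image_iff)
qed

section \<open>The transfer function of a finite group\<close>

text \<open>Elements of \<open>F\<close> lie in the full group but in general not in
  \<open>\<Gamma>\<close>, so \<open>a\<close> cannot be evaluated on them. The element that moves
  \<open>x\<close> to the selected point of its \<open>F\<close>-orbit is therefore taken from
  \<open>\<Gamma>\<close> and depends on \<open>x\<close>.\<close>

lemma finite_group_transfer:
  fixes a :: "('x \<Rightarrow> 'x) \<times> 'x \<Rightarrow> 'g::{topological_ab_group_add, second_countable_topology}"
  assumes X: "standard_borel X" and \<Gamma>: "borel_aut_subgroup X \<Gamma>" "countable \<Gamma>" "acts_freely X \<Gamma>"
    and F: "finite F" "borel_aut_subgroup X F" "F \<subseteq> full_group X \<Gamma>"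
    and a: "a \<in> cocycles X \<Gamma>"
  obtains c where "c \<in> borel_fun X"
    and "\<And>\<gamma> x. \<gamma> \<in> \<Gamma> \<Longrightarrow> x \<in> space X \<Longrightarrow> \<gamma> x \<in> orbit_of F x \<Longrightarrow> a (\<gamma>, x) = c (\<gamma> x) - c x"
proof -
  obtain B where B: "borel_separating X B"
    using standard_borel_separating[OF X] ..
  note \<Gamma>_meas = borel_aut_subgroupD(1)[OF \<Gamma>(1)] and F_meas = borel_aut_subgroupD(1)[OF F(2)]
  note \<Gamma>_space = borel_aut_subgroup_simps(3)[OF \<Gamma>(1)]
  note F_space = borel_aut_subgroup_simps(3)[OF F(2)]
  \<comment> \<open>\<open>P \<gamma> x\<close> says that \<open>\<gamma>\<close> moves
    \<open>x\<close> to the lexicographically least point of its \<open>F\<close>-orbit. As a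
    condition on \<open>\<gamma>\<close> it describes the fibres of \<open>t\<close>
    directly.\<close>
  define P where "P \<gamma> x \<longleftrightarrow> \<gamma> x \<in> orbit_of F x \<and> (\<forall>y\<in>orbit_of F x. \<not> lex_less B y (\<gamma> x))" for \<gamma> x
  have orbit_space: "y \<in> space X" if "y \<in> orbit_of F x" "x \<in> space X" for x y
    using that F_space by (auto simp: orbit_of_def)
  have P_unique: "y = z" if "x \<in> space X" "y \<in> orbit_of F x" "z \<in> orbit_of F x"
    "\<forall>w\<in>orbit_of F x. \<not> lex_less B w y" "\<forall>w\<in>orbit_of F x. \<not> lex_less B w z" for x y z
    using that lex_less_total[of y B z] borel_separatingD(2)[OF B, of y z] orbit_space by metis
  have P_ex: "\<exists>!\<gamma>. \<gamma> \<in> \<Gamma> \<and> P \<gamma> x" if x: "x \<in> space X" for x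
  proof (rule ex_ex1I)
    have "finite (orbit_of F x)" "orbit_of F x \<noteq> {}"
      using F(1) borel_aut_subgroup_simps(1)[OF F(2)] by (auto simp: orbit_of_def)
    then obtain m where m: "m \<in> orbit_of F x" "\<forall>y\<in>orbit_of F x. \<not> lex_less B y m"
      using lex_less_has_min by metis
    \<comment> \<open>The minimum lies in the \<open>\<Gamma>\<close>-orbit of \<open>x\<close>
      because \<open>F\<close> is contained in the full group.\<close>
    moreover obtain \<gamma> where "\<gamma> \<in> \<Gamma>" "m = \<gamma> x"
      using m(1) F(3) x by (fastforce simp: orbit_of_def full_group_def)
    ultimately show "\<exists>\<gamma>. \<gamma> \<in> \<Gamma> \<and> P \<gamma> x" unfolding P_def by blast
    \<comment> \<open>The minimum is unique as a point, and freeness then makes the group element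
      unique.\<close>
    show "\<gamma> = \<eta>" if "\<gamma> \<in> \<Gamma> \<and> P \<gamma> x" "\<eta> \<in> \<Gamma> \<and> P \<eta> x" for \<gamma> \<eta>
      using that acts_freely_inj[OF \<Gamma>(1,3) _ _ x] P_unique[OF x] unfolding P_def by blast
  qed
  define t where "t x = (THE \<gamma>. \<gamma> \<in> \<Gamma> \<and> P \<gamma> x)" for x
  have t: "t x \<in> \<Gamma>" "P (t x) x" if "x \<in> space X" for x
    using theI'[OF P_ex[OF that]] unfolding t_def by auto
  have t_eq: "t x = \<gamma>" if "x \<in> space X" "\<gamma> \<in> \<Gamma>" "P \<gamma> x" for x \<gamma>
    using P_ex[OF that(1)] t[OF that(1)] that(2,3) by blast
  have P_meas: "Measurable.pred X (P \<gamma>)" if "\<gamma> \<in> \<Gamma>" for \<gamma>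
  proof -
    have "Measurable.pred X (\<lambda>x. \<forall>g\<in>F. \<not> lex_less B (g x) (\<gamma> x))"
      using F(1) pred_lex_less[OF borel_separatingD(1)[OF B] F_meas \<Gamma>_meas[OF that]]
      by (intro pred_intros_finite pred_intros_logic) auto
    moreover have "P \<gamma> = (\<lambda>x. \<gamma> x \<in> orbit_of F x \<and> (\<forall>g\<in>F. \<not> lex_less B (g x) (\<gamma> x)))"
      by (auto simp: P_def orbit_of_def fun_eq_iff)
    ultimately show ?thesis
      using pred_orbit_of[OF X F(1,2) \<Gamma>_meas[OF that]] by (simp add: pred_intros_logic)
  qed
  \<comment> \<open>As \<open>\<Gamma>\<close> is countable, only the fibres of \<open>t\<close>
    need to be Borel, and the fibre over \<open>\<gamma>\<close> is the set where
    \<open>P \<gamma>\<close> holds.\<close>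
  have t_meas: "t \<in> X \<rightarrow>\<^sub>M count_space \<Gamma>"
  proof (subst measurable_count_space_eq_countable[OF \<Gamma>(2)], intro conjI ballI)
    show "t \<in> space X \<rightarrow> \<Gamma>" using t by auto
    fix \<gamma> assume \<gamma>: "\<gamma> \<in> \<Gamma>"
    have "t -` {\<gamma>} \<inter> space X = {x \<in> space X. P \<gamma> x}"
      using t t_eq \<gamma> by auto
    then show "t -` {\<gamma>} \<inter> space X \<in> sets X"
      using P_meas[OF \<gamma>] by (simp add: pred_def)
  qed
  have a_meas: "(\<lambda>x. a (\<gamma>, x)) \<in> X \<rightarrow>\<^sub>M borel" if "\<gamma> \<in> \<Gamma>" for \<gamma>
  proof -
    have "a \<in> count_space \<Gamma> \<Otimes>\<^sub>M X \<rightarrow>\<^sub>M borel"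
      using a by (simp add: cocycles_def borel_fun_def action_space_def)
    then show ?thesis using that by (intro measurable_Pair_compose_split[of "curry a", simplified]) auto
  qed
  \<comment> \<open>The inner restriction is an element of \<open>borel_fun X\<close>, so
    \<open>uminus_borel_fun\<close> applies to it verbatim.\<close>
  define c where "c = (\<lambda>x\<in>space X. - (\<lambda>x\<in>space X. a (t x, x)) x)"
  \<comment> \<open>Countably many Borel sections of \<open>a\<close> are glued along the fibres of
    \<open>t\<close>.\<close>
  have "(\<lambda>x. a (t x, x)) \<in> X \<rightarrow>\<^sub>M borel"
    by (rule measurable_compose_countable'[OF a_meas t_meas \<Gamma>(2)])
  then have "(\<lambda>x\<in>space X. a (t x, x)) \<in> borel_fun X"
    by (simp add: borel_fun_def cong: measurable_cong)
  then have c: "c \<in> borel_fun X" unfolding c_def by (rule uminus_borel_fun)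
  have "a (\<gamma>, x) = c (\<gamma> x) - c x"
    if \<gamma>: "\<gamma> \<in> \<Gamma>" and x: "x \<in> space X" and orb: "\<gamma> x \<in> orbit_of F x" for \<gamma> x
  proof -
    \<comment> \<open>The points \<open>x\<close> and \<open>\<gamma> x\<close> share their
      \<open>F\<close>-orbit and hence its minimum. So \<open>?\<theta>\<close> moves
      \<open>x\<close> to that minimum, which forces \<open>t x = ?\<theta>\<close>; the cocycle
      identity for this product is the claim.\<close>
    let ?\<theta> = "t (\<gamma> x) \<otimes>\<^bsub>BijGroup (space X)\<^esub> \<gamma>"
    have y: "\<gamma> x \<in> space X" using \<Gamma>_space[OF \<gamma> x] .
    obtain g where "g \<in> F" "\<gamma> x = g x"
      using orb by (auto simp: orbit_of_def)
    then have same: "orbit_of F (\<gamma> x) = orbit_of F x"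
      using orbit_of_apply[OF F(2) _ x] by simp
    have ap: "?\<theta> x = t (\<gamma> x) (\<gamma> x)"
      by (rule borel_aut_subgroupD(3)[OF \<Gamma>(1) t(1)[OF y] \<gamma> x])
    have "P ?\<theta> x" using t(2)[OF y] unfolding P_def ap same .
    then have "t x = ?\<theta>"
      using t_eq[OF x] borel_aut_subgroup_simps(2)[OF \<Gamma>(1) t(1)[OF y] \<gamma>] by blast
    then have "a (t x, x) = a (t (\<gamma> x), \<gamma> x) + a (\<gamma>, x)"
      using a t(1)[OF y] \<gamma> x by (simp add: cocycles_def)
    then show ?thesis using x y by (simp add: c_def)
  qed
  with c show thesis by (rule that)
qed

section \<open>Coboundaries of Borel functions and density\<close>

text \<open>Joint measurability reduces to the sections at each of the countably many
  \<open>\<gamma>\<close>, and the cocycle identity is a telescoping sum.\<close>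

lemma coboundary_of_borel_fun:
  fixes c :: "'x \<Rightarrow> 'g::{topological_ab_group_add, second_countable_topology}"
  assumes \<Gamma>: "borel_aut_subgroup X \<Gamma>" "countable \<Gamma>" and c: "c \<in> borel_fun X"
  shows "(\<lambda>p\<in>\<Gamma> \<times> space X. c (fst p (snd p)) - c (snd p)) \<in> coboundaries X \<Gamma>"
    (is "?b \<in> _")
proof -
  note [simp] = borel_aut_subgroup_simps[OF \<Gamma>(1)]
  have sp: "space (action_space X \<Gamma>) = \<Gamma> \<times> space X"
    by (simp add: action_space_def space_pair_measure)
  have cm: "c \<in> X \<rightarrow>\<^sub>M borel" and ncm: "(\<lambda>x\<in>space X. - c x) \<in> X \<rightarrow>\<^sub>M borel"
    using c uminus_borel_fun[OF c] by (auto simp: borel_fun_def)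
  have "(\<lambda>p. c (fst p (snd p)) - c (snd p)) \<in> count_space \<Gamma> \<Otimes>\<^sub>M X \<rightarrow>\<^sub>M borel"
  proof (rule measurable_pair_measure_countable1[OF \<Gamma>(2)])
    fix \<gamma> assume \<gamma>: "\<gamma> \<in> \<Gamma>"
    \<comment> \<open>The difference is written as a sum with the negated function, whose
      measurability is \<open>ncm\<close>.\<close>
    have "(\<lambda>x. c (\<gamma> x) + (\<lambda>x\<in>space X. - c x) x) \<in> X \<rightarrow>\<^sub>M borel"
      by (intro borel_measurable_add measurable_compose[OF borel_aut_subgroupD(1)[OF \<Gamma>(1) \<gamma>] cm] ncm)
    then show "(\<lambda>x. c (fst (\<gamma>, x) (snd (\<gamma>, x))) - c (snd (\<gamma>, x))) \<in> X \<rightarrow>\<^sub>M borel"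
      by (simp cong: measurable_cong)
  qed
  then have "?b \<in> borel_fun (action_space X \<Gamma>)"
    unfolding borel_fun_def sp[symmetric] by (simp add: action_space_def cong: measurable_cong)
  then have "?b \<in> cocycles X \<Gamma>"
    by (simp add: cocycles_def borel_aut_subgroupD(3)[OF \<Gamma>(1)] one_BijGroup_apply)
  then show ?thesis using c unfolding coboundaries_def by auto
qed

theorem theorem4p1:
  fixes X :: "'x measure"
    and \<Gamma> :: "('x \<Rightarrow> 'x) set"
    and d :: "'g::{topological_ab_group_add, second_countable_topology, t2_space} \<Rightarrow> 'g \<Rightarrow> real"
  assumes "standard_borel X"
    and "borel_aut_subgroup X \<Gamma>"
    and "countable \<Gamma>"
    and "hyperfinite X \<Gamma>"
    and "acts_freely X \<Gamma>"
    and "locally_compact_space (euclidean :: 'g topology)"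
    and "invariant_compatible_metric d"
  shows "(subtopology (topology_T d (action_space X \<Gamma>)) (cocycles X \<Gamma>))
           closure_of (coboundaries X \<Gamma>) = cocycles X \<Gamma>"
proof
  let ?Y = "action_space X \<Gamma>"
  let ?Z = "cocycles X \<Gamma> :: (_ \<Rightarrow> 'g) set"
  let ?S = "subtopology (topology_T d ?Y) ?Z"
  have Zsub: "?Z \<subseteq> borel_fun ?Y" by (auto simp: cocycles_def)
  then have top: "topspace ?S = ?Z"
    by (auto simp: topspace_topology_T[OF assms(7)])
  then show "?S closure_of (coboundaries X \<Gamma>) \<subseteq> ?Z"
    using closure_of_subset_topspace by metis
  show "?Z \<subseteq> ?S closure_of (coboundaries X \<Gamma>)"
  proof
    fix a assume a: "a \<in> ?Z"
    have sp: "space ?Y = \<Gamma> \<times> space X"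
      by (simp add: action_space_def space_pair_measure)
    interpret d: Metric_space UNIV d
      using assms(7) by (simp add: invariant_compatible_metric_def)
    obtain \<Gamma>s where fin: "\<And>i. finite (\<Gamma>s i)" and sub: "\<And>i. borel_aut_subgroup X (\<Gamma>s i)"
      and full: "\<And>i. \<Gamma>s i \<subseteq> full_group X \<Gamma>" and inc: "\<And>i. \<Gamma>s i \<subseteq> \<Gamma>s (Suc i)"
      and orb: "\<And>x. x \<in> space X \<Longrightarrow> orbit_of \<Gamma> x = (\<Union>i. orbit_of (\<Gamma>s i) x)"
      using assms(4) unfolding hyperfinite_def by metis
    \<comment> \<open>The exceptional set: outside it, the transfer function for
      \<open>\<Gamma>s i\<close> reproduces \<open>a\<close> exactly.\<close>
    define A where "A i = {p \<in> space ?Y. fst p (snd p) \<notin> orbit_of (\<Gamma>s i) (snd p)}" for i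
    have A_sets: "A i \<in> sets ?Y" for i
    proof -
      have "(\<lambda>p. fst p (snd p) \<in> orbit_of (\<Gamma>s i) (snd p))
              \<in> count_space \<Gamma> \<Otimes>\<^sub>M X \<rightarrow>\<^sub>M count_space UNIV"
        using pred_orbit_of[OF assms(1) fin sub borel_aut_subgroupD(1)[OF assms(2)]]
        by (intro measurable_pair_measure_countable1[OF assms(3)]) simp
      then have "Measurable.pred ?Y (\<lambda>p. fst p (snd p) \<notin> orbit_of (\<Gamma>s i) (snd p))"
        unfolding action_space_def by (rule pred_intros_logic)
      then show ?thesis by (simp add: A_def pred_def)
    qed
    have A_dec: "decseq A"
      unfolding decseq_Suc_iff using inc by (fastforce simp: A_def orbit_of_def)
    \<comment> \<open>Hyperfiniteness: each point of a \<open>\<Gamma>\<close>-orbit is reached by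
      some \<open>\<Gamma>s i\<close>.\<close>
    have A_empty: "(\<Inter>i. A i) = {}"
    proof -
      have False if p: "\<forall>i. p \<in> A i" for p
      proof -
        from p have "fst p \<in> \<Gamma>" "snd p \<in> space X" by (auto simp: A_def sp)
        then have "fst p (snd p) \<in> orbit_of \<Gamma> (snd p)" by (auto simp: orbit_of_def)
        then have "fst p (snd p) \<in> (\<Union>i. orbit_of (\<Gamma>s i) (snd p))"
          using orb[OF \<open>snd p \<in> space X\<close>] by blast
        then show False using p by (auto simp: A_def)
      qed
      then show ?thesis by blast
    qed
    have "\<exists>b. b \<in> coboundaries X \<Gamma> \<and> b \<in> W" if W: "openin ?S W" "a \<in> W" for W
    proof -
      obtain V where V: "openin_T d ?Y V" "W = V \<inter> ?Z"
        using W(1) by (auto simp: openin_subtopology openin_topology_T[OF assms(7)])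
      then obtain \<M> \<epsilon> \<delta> where M: "finite \<M>" "\<M> \<subseteq> space (prob_algebra ?Y)" and \<epsilon>: "\<epsilon> > 0"
        and \<delta>: "\<delta> > 0" and nb: "basic_nbhd d ?Y a \<M> \<epsilon> \<delta> \<subseteq> V"
        using W(2) unfolding openin_T_def by (meson IntD1)
      \<comment> \<open>Continuity from above of each finite measure along the decreasing sets
        \<open>A i\<close>.\<close>
      have "\<forall>\<^sub>F i in sequentially. measure \<mu> (A i) < \<delta>" if \<mu>: "\<mu> \<in> \<M>" for \<mu>
      proof -
        from \<mu> M have s: "sets \<mu> = sets ?Y" and "prob_space \<mu>" by (auto simp: space_prob_algebra)
        then interpret prob_space \<mu> by simp
        have "(\<lambda>i. measure \<mu> (A i)) \<longlonglongrightarrow> measure \<mu> (\<Inter>i. A i)"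
          using A_sets s A_dec by (intro finite_Lim_measure_decseq) auto
        then show ?thesis using \<delta> by (intro order_tendstoD) (simp_all add: A_empty)
      qed
      \<comment> \<open>A basic neighbourhood involves only finitely many measures, so one index
        \<open>i\<close> serves them all.\<close>
      then have "\<forall>\<^sub>F i in sequentially. \<forall>\<mu>\<in>\<M>. measure \<mu> (A i) < \<delta>"
        using M(1) by (intro eventually_ball_finite) auto
      from eventually_happens'[OF sequentially_bot this]
      obtain i where i: "\<forall>\<mu>\<in>\<M>. measure \<mu> (A i) < \<delta>" by (rule exE)
      obtain c where c: "c \<in> borel_fun X"
        "\<And>\<gamma> x. \<gamma> \<in> \<Gamma> \<Longrightarrow> x \<in> space X \<Longrightarrow> \<gamma> x \<in> orbit_of (\<Gamma>s i) x \<Longrightarrow> a (\<gamma>, x) = c (\<gamma> x) - c x"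
        using finite_group_transfer[OF assms(1-3,5) fin sub full a] by metis
      define b where "b = (\<lambda>p\<in>\<Gamma> \<times> space X. c (fst p (snd p)) - c (snd p))"
      have b: "b \<in> coboundaries X \<Gamma>"
        unfolding b_def by (rule coboundary_of_borel_fun[OF assms(2,3) c(1)])
      then have bZ: "b \<in> ?Z" by (simp add: coboundaries_def)
      \<comment> \<open>Off \<open>A i\<close> the functions \<open>a\<close> and \<open>b\<close>
        coincide, so their distance is 0 there, whatever \<open>\<epsilon>\<close> is.\<close>
      have exc: "{y \<in> space ?Y. d (a y) (b y) > \<epsilon>} \<subseteq> A i"
        using c(2) \<epsilon> by (auto simp: A_def sp b_def)
      have "measure \<mu> {y \<in> space ?Y. d (a y) (b y) > \<epsilon>} < \<delta>" if \<mu>: "\<mu> \<in> \<M>" for \<mu>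
      proof -
        from \<mu> M have s: "sets \<mu> = sets ?Y" and "prob_space \<mu>" by (auto simp: space_prob_algebra)
        then interpret prob_space \<mu> by simp
        have "measure \<mu> {y \<in> space ?Y. d (a y) (b y) > \<epsilon>} \<le> measure \<mu> (A i)"
          using exc A_sets s by (intro finite_measure_mono) auto
        also have "\<dots> < \<delta>" using i \<mu> by blast
        finally show ?thesis .
      qed
      then have "b \<in> basic_nbhd d ?Y a \<M> \<epsilon> \<delta>"
        using bZ Zsub by (auto simp: basic_nbhd_def)
      then show ?thesis using b bZ nb V(2) by blast
    qed
    then show "a \<in> ?S closure_of (coboundaries X \<Gamma>)"
      unfolding in_closure_of top using a by blast
  qed
qed

end
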